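(* For every signature $\tau$ with $\{+,\cdot\}\subseteq\tau\subseteq\{+,\cdot,\copyright,!,\exp_2,0,1\}$, the algebra $S_7^0$, with the operations in $\tau$, has no finite basis for its identities (no finite set of equations true in it entails all equations true in it).
   Context: $S_7^0$ is the algebra on $\{0,1,a,\infty\}$ with constants $0,1$ and the following operations (the row is the left argument, the column the right argument): $$\begin{array}{c|cccc} + & 0 & 1 & a & \infty \\ \hline 0 & 0 & 1 & a & \infty \\ 1 & 1 & 1 & \infty & \infty \\ a & a & \infty & a & \infty \\ \infty & \infty & \infty & \infty & \infty \end{array}\qquad\begin{array}{c|cccc} \cdot & 0 & 1 & a & \infty \\ \hline 0 & 0 & 0 & 0 & 0 \\ 1 & 0 & 1 & a & \infty \\ a & 0 & a & \infty & \infty \\ \infty & 0 & \infty & \infty & \infty \end{array}\qquad\begin{array}{c|cccc} \copyright & 0 & 1 & a & \infty \\ \hline 0 & 1 & 1 & 1 & 1 \\ 1 & 1 & 1 & \infty & \infty \\ a & 1 & \infty & \infty & \infty \\ \infty & 1 & \infty & \infty & \infty \end{array}$$ and unary operations $0!=1,\ 1!=1,\ a!=\infty,\ \infty!=\infty$; $\exp_2(0)=1,\ \exp_2(1)=1,\ \exp_2(a)=\infty,\ \exp_2(\infty)=\infty$. For a signature $\tau$ as in the claim, only the operations (and constants) in $\tau$ are retained. *)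

theory Defs
  imports "HOL-Library.Countable_Set"
begin

text \<open>
  The largest signature under consideration. A signature is a set \<open>\<tau>\<close> of these symbols:
  \<open>CopyS\<close> is the binary symbol written as a circled C, and \<open>FactS\<close>, \<open>Exp2S\<close> are unary.
\<close>

datatype symb = PlusS | TimesS | CopyS | FactS | Exp2S | ZeroS | OneS

datatype trm =
    Var nat
  | Zero
  | One
  | Plus trm trm
  | Times trm trm
  | Copy trm trm
  | Fact trm
  | Exp2 trm

primrec symbs :: "trm \<Rightarrow> symb set" where
  "symbs (Var n) = {}"
| "symbs Zero = {ZeroS}"
| "symbs One = {OneS}"
| "symbs (Plus s t) = insert PlusS (symbs s \<union> symbs t)"
| "symbs (Times s t) = insert TimesS (symbs s \<union> symbs t)"
| "symbs (Copy s t) = insert CopyS (symbs s \<union> symbs t)"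
| "symbs (Fact t) = insert FactS (symbs t)"
| "symbs (Exp2 t) = insert Exp2S (symbs t)"

definition terms :: "symb set \<Rightarrow> trm set" where
  "terms \<tau> = {t. symbs t \<subseteq> \<tau>}"

type_synonym equation = "trm \<times> trm"

text \<open>
  One record serves for all signatures. Taken as an algebra of signature \<open>\<tau>\<close>, only the operations
  in \<open>\<tau>\<close> are retained: the other fields are unconstrained, and no term over \<open>\<tau>\<close> mentions them.
\<close>

record 'a alg =
  car :: "'a set"
  plus_op :: "'a \<Rightarrow> 'a \<Rightarrow> 'a"
  times_op :: "'a \<Rightarrow> 'a \<Rightarrow> 'a"
  copy_op :: "'a \<Rightarrow> 'a \<Rightarrow> 'a"
  fact_op :: "'a \<Rightarrow> 'a"
  exp2_op :: "'a \<Rightarrow> 'a"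
  zero_op :: 'a
  one_op :: 'a

definition algebra_of :: "symb set \<Rightarrow> 'a alg \<Rightarrow> bool" where
  "algebra_of \<tau> A \<longleftrightarrow>
     car A \<noteq> {} \<and>
     (PlusS \<in> \<tau> \<longrightarrow> (\<forall>x\<in>car A. \<forall>y\<in>car A. plus_op A x y \<in> car A)) \<and>
     (TimesS \<in> \<tau> \<longrightarrow> (\<forall>x\<in>car A. \<forall>y\<in>car A. times_op A x y \<in> car A)) \<and>
     (CopyS \<in> \<tau> \<longrightarrow> (\<forall>x\<in>car A. \<forall>y\<in>car A. copy_op A x y \<in> car A)) \<and>
     (FactS \<in> \<tau> \<longrightarrow> (\<forall>x\<in>car A. fact_op A x \<in> car A)) \<and>
     (Exp2S \<in> \<tau> \<longrightarrow> (\<forall>x\<in>car A. exp2_op A x \<in> car A)) \<and>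
     (ZeroS \<in> \<tau> \<longrightarrow> zero_op A \<in> car A) \<and>
     (OneS \<in> \<tau> \<longrightarrow> one_op A \<in> car A)"

primrec eval :: "'a alg \<Rightarrow> (nat \<Rightarrow> 'a) \<Rightarrow> trm \<Rightarrow> 'a" where
  "eval A v (Var n) = v n"
| "eval A v Zero = zero_op A"
| "eval A v One = one_op A"
| "eval A v (Plus s t) = plus_op A (eval A v s) (eval A v t)"
| "eval A v (Times s t) = times_op A (eval A v s) (eval A v t)"
| "eval A v (Copy s t) = copy_op A (eval A v s) (eval A v t)"
| "eval A v (Fact t) = fact_op A (eval A v t)"
| "eval A v (Exp2 t) = exp2_op A (eval A v t)"

definition satisfies :: "'a alg \<Rightarrow> equation \<Rightarrow> bool" where
  "satisfies A e \<longleftrightarrow> (\<forall>v. range v \<subseteq> car A \<longrightarrow> eval A v (fst e) = eval A v (snd e))"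

definition identities :: "symb set \<Rightarrow> 'a alg \<Rightarrow> equation set" where
  "identities \<tau> A = {e \<in> terms \<tau> \<times> terms \<tau>. satisfies A e}"

text \<open>
  Entailment means truth in all models. A definition cannot quantify over types, so it is stated
  for the models whose carrier is a set of natural numbers, i.e. (up to isomorphism) the countable
  ones. Lemma \<open>entails_all_algebras\<close> below shows that models over every other type are then
  covered as well.
\<close>

definition entails :: "symb set \<Rightarrow> equation set \<Rightarrow> equation \<Rightarrow> bool" where
  "entails \<tau> E e \<longleftrightarrow>
     (\<forall>A :: nat alg. algebra_of \<tau> A \<and> (\<forall>d\<in>E. satisfies A d) \<longrightarrow> satisfies A e)"

definition finitely_based :: "symb set \<Rightarrow> 'a alg \<Rightarrow> bool" where
  "finitely_based \<tau> A \<longleftrightarrow>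
     (\<exists>E. finite E \<and> E \<subseteq> identities \<tau> A \<and> (\<forall>e\<in>identities \<tau> A. entails \<tau> E e))"

instance trm :: countable
  by countable_datatype

lemma eval_in_car:
  assumes "algebra_of \<tau> A" "range v \<subseteq> car A" "t \<in> terms \<tau>"
  shows "eval A v t \<in> car A"
  using assms(3) by (induction t) (use assms(1,2) in \<open>auto simp: terms_def algebra_of_def\<close>)

text \<open>The subalgebra generated by a countable family is countable, so it has a copy on the naturals.\<close>

theorem entails_all_algebras:
  fixes A :: "'a alg"
  assumes ent: "entails \<tau> E e" and E: "E \<subseteq> terms \<tau> \<times> terms \<tau>" and e: "e \<in> terms \<tau> \<times> terms \<tau>"
    and A: "algebra_of \<tau> A" and sat: "\<forall>d\<in>E. satisfies A d"
  shows "satisfies A e"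
  unfolding satisfies_def
proof (intro allI impI)
  fix v :: "nat \<Rightarrow> 'a" assume v: "range v \<subseteq> car A"
  define B where "B = eval A v ` terms \<tau>"
  have BA: "B \<subseteq> car A" using eval_in_car[OF A v] by (auto simp: B_def)
  have "countable B" by (simp add: B_def)
  define f where "f = to_nat_on B"
  define g where "g = from_nat_into B"
  have gf: "g (f x) = x" if "x \<in> B" for x
    using that \<open>countable B\<close> by (simp add: f_def g_def)
  define N :: "nat alg" where "N = \<lparr>car = f ` B,
     plus_op = (\<lambda>x y. f (plus_op A (g x) (g y))),
     times_op = (\<lambda>x y. f (times_op A (g x) (g y))),
     copy_op = (\<lambda>x y. f (copy_op A (g x) (g y))),
     fact_op = (\<lambda>x. f (fact_op A (g x))),
     exp2_op = (\<lambda>x. f (exp2_op A (g x))),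
     zero_op = f (zero_op A), one_op = f (one_op A)\<rparr>"
  have ne: "v n \<in> B" for n
    unfolding B_def by (rule image_eqI[of _ _ "Var n"]) (auto simp: terms_def)
  have cl: "PlusS \<in> \<tau> \<Longrightarrow> x \<in> B \<Longrightarrow> y \<in> B \<Longrightarrow> plus_op A x y \<in> B"
    "TimesS \<in> \<tau> \<Longrightarrow> x \<in> B \<Longrightarrow> y \<in> B \<Longrightarrow> times_op A x y \<in> B"
    "CopyS \<in> \<tau> \<Longrightarrow> x \<in> B \<Longrightarrow> y \<in> B \<Longrightarrow> copy_op A x y \<in> B"
    "FactS \<in> \<tau> \<Longrightarrow> x \<in> B \<Longrightarrow> fact_op A x \<in> B"
    "Exp2S \<in> \<tau> \<Longrightarrow> x \<in> B \<Longrightarrow> exp2_op A x \<in> B"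
    "ZeroS \<in> \<tau> \<Longrightarrow> zero_op A \<in> B" "OneS \<in> \<tau> \<Longrightarrow> one_op A \<in> B" for x y
  proof -
    have *: "eval A v t \<in> B" if "t \<in> terms \<tau>" for t using that by (auto simp: B_def)
    show "PlusS \<in> \<tau> \<Longrightarrow> x \<in> B \<Longrightarrow> y \<in> B \<Longrightarrow> plus_op A x y \<in> B"
      using *[of "Plus s t" for s t] by (auto simp: B_def terms_def)
    show "TimesS \<in> \<tau> \<Longrightarrow> x \<in> B \<Longrightarrow> y \<in> B \<Longrightarrow> times_op A x y \<in> B"
      using *[of "Times s t" for s t] by (auto simp: B_def terms_def)
    show "CopyS \<in> \<tau> \<Longrightarrow> x \<in> B \<Longrightarrow> y \<in> B \<Longrightarrow> copy_op A x y \<in> B"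
      using *[of "Copy s t" for s t] by (auto simp: B_def terms_def)
    show "FactS \<in> \<tau> \<Longrightarrow> x \<in> B \<Longrightarrow> fact_op A x \<in> B"
      using *[of "Fact t" for t] by (auto simp: B_def terms_def)
    show "Exp2S \<in> \<tau> \<Longrightarrow> x \<in> B \<Longrightarrow> exp2_op A x \<in> B"
      using *[of "Exp2 t" for t] by (auto simp: B_def terms_def)
    show "ZeroS \<in> \<tau> \<Longrightarrow> zero_op A \<in> B" using *[of Zero] by (auto simp: terms_def)
    show "OneS \<in> \<tau> \<Longrightarrow> one_op A \<in> B" using *[of One] by (auto simp: terms_def)
  qed
  have N: "algebra_of \<tau> N"
    using ne cl by (auto simp: algebra_of_def N_def gf)
  have ev: "eval A w t \<in> B \<and> eval N (\<lambda>n. f (w n)) t = f (eval A w t)"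
    if w: "range w \<subseteq> B" and t: "t \<in> terms \<tau>" for w :: "nat \<Rightarrow> 'a" and t
    using t by (induction t) (use w cl in \<open>auto simp: terms_def N_def gf\<close>)
  have "satisfies N d" if "d \<in> E" for d
    unfolding satisfies_def
  proof (intro allI impI)
    fix u :: "nat \<Rightarrow> nat" assume u: "range u \<subseteq> car N"
    define w where "w = (\<lambda>n. g (u n))"
    have "u n \<in> f ` B" for n using u by (auto simp: N_def)
    then have wn: "w n \<in> B \<and> u n = f (w n)" for n
      unfolding w_def by (metis gf imageE)
    then have w: "range w \<subseteq> B" and uw: "u = (\<lambda>n. f (w n))"
      by auto
    have "eval A w (fst d) = eval A w (snd d)"
      using sat \<open>d \<in> E\<close> w BA unfolding satisfies_def by blast
    then show "eval N u (fst d) = eval N u (snd d)"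
      using ev[OF w] E \<open>d \<in> E\<close> by (force simp: uw)
  qed
  then have "satisfies N e" using ent N by (auto simp: entails_def)
  moreover have "range (\<lambda>n. f (v n)) \<subseteq> car N" using ne by (auto simp: N_def)
  ultimately have "eval N (\<lambda>n. f (v n)) (fst e) = eval N (\<lambda>n. f (v n)) (snd e)"
    by (auto simp: satisfies_def)
  then have "f (eval A v (fst e)) = f (eval A v (snd e))" and
    "eval A v (fst e) \<in> B" "eval A v (snd e) \<in> B"
    using ev[of v] ne e by (auto simp: image_subset_iff)
  then show "eval A v (fst e) = eval A v (snd e)" by (metis gf)
qed

datatype s7 = E0 | E1 | Ea | Einf

text \<open>In the following tables, overlapping equations are read in order, the first match applies.\<close>

fun s7_plus :: "s7 \<Rightarrow> s7 \<Rightarrow> s7" where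
  "s7_plus E0 y = y"
| "s7_plus x E0 = x"
| "s7_plus E1 E1 = E1"
| "s7_plus Ea Ea = Ea"
| "s7_plus _ _ = Einf"

fun s7_times :: "s7 \<Rightarrow> s7 \<Rightarrow> s7" where
  "s7_times E0 _ = E0"
| "s7_times _ E0 = E0"
| "s7_times E1 y = y"
| "s7_times x E1 = x"
| "s7_times _ _ = Einf"

fun s7_copy :: "s7 \<Rightarrow> s7 \<Rightarrow> s7" where
  "s7_copy E0 _ = E1"
| "s7_copy _ E0 = E1"
| "s7_copy E1 E1 = E1"
| "s7_copy _ _ = Einf"

fun s7_fact :: "s7 \<Rightarrow> s7" where
  "s7_fact E0 = E1"
| "s7_fact E1 = E1"
| "s7_fact Ea = Einf"
| "s7_fact Einf = Einf"

fun s7_exp2 :: "s7 \<Rightarrow> s7" where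
  "s7_exp2 E0 = E1"
| "s7_exp2 E1 = E1"
| "s7_exp2 Ea = Einf"
| "s7_exp2 Einf = Einf"

definition S70 :: "s7 alg" where
  "S70 = \<lparr>car = UNIV, plus_op = s7_plus, times_op = s7_times, copy_op = s7_copy,
          fact_op = s7_fact, exp2_op = s7_exp2, zero_op = E0, one_op = E1\<rparr>"

lemma algebra_of_S70: "algebra_of \<tau> S70"
  by (simp add: algebra_of_def S70_def)

end

theory Submission
  imports Defs "HOL-Library.Nat_Bijection"
begin

text \<open>
  In \<open>S70\<close>, a sum of nonzero elements differs from \<open>\<infinity>\<close> only if all summands are equal, and a product
  is \<open>a\<close> only if exactly one factor is \<open>a\<close> and the others are 1. Let \<open>H\<close> be a hypergraph whose
  edges have three points, read the points as variables, and let \<open>\<sigma>\<close> be the sum over all edges of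
  the product of their points. A valuation without zeros that gives \<open>\<sigma>\<close> the value \<open>a\<close> is the same as
  an exactly-one colouring: a set of points that meets every edge in exactly one point. If \<open>H\<close>
  has no such colouring, then \<open>\<sigma> = \<sigma> + q \<sqdot> q\<close> is an identity of \<open>S70\<close>, where \<open>q\<close> is the product of all
  points (\<open>critical_equation_S70\<close>). The factor \<open>q\<close> takes care of zeros: a valuation can make \<open>\<sigma>\<close>
  equal to \<open>a\<close> only by killing some edges, and then \<open>q\<close> vanishes.

  This identity does not follow from identities with few variables if \<open>H\<close> is locally acyclic. The
  algebra \<open>hyper_alg H\<close> is generated by the points of \<open>H\<close>, with the relation that every edge has the
  product \<open>Atom\<close>, the counterpart of \<open>a\<close>. It violates the identity: \<open>\<sigma>\<close> becomes \<open>Atom\<close> and the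
  right side becomes \<open>Top\<close> (\<open>critical_equation_hyper_alg\<close>). But a valuation of a few variables
  involves only a few edges, and these form an acyclic family. Such a family has so many
  exactly-one colourings (\<open>leafy_colouring\<close>) that the corresponding maps to \<open>S70\<close> determine the
  values of all terms: they are compatible with evaluation below \<open>Top\<close> (\<open>eval_transl\<close>), they
  separate elements (\<open>transl_separates\<close>), and they detect \<open>Top\<close> (\<open>eval_Top\<close>). So every identity of
  \<open>S70\<close> in these variables holds in \<open>hyper_alg H\<close> (\<open>hyper_alg_satisfies\<close>).

  It remains to find, for each bound, a finite hypergraph that is acyclic up to this bound and has
  no exactly-one colouring (\<open>leafy_hypergraph_exists\<close>). If every point lies in exactly three edges
  and there are as many edges as points, such a colouring consists of a third of the points, so it
  suffices that their number is a power of two. The neighbourhoods in a cubic graph of large girth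
  have these properties, and repeated covers of a one-point graph supply a graph with \<open>2 ^ k\<close>
  points.
\<close>

section \<open>Edge-coloured cubic graphs of large girth\<close>

primrec walk :: "(nat \<Rightarrow> 'a \<Rightarrow> 'a) \<Rightarrow> nat list \<Rightarrow> 'a \<Rightarrow> 'a" where
  "walk s [] x = x"
| "walk s (i # is) x = walk s is (s i x)"

lemma walk_append: "walk s (is @ js) x = walk s js (walk s is x)"
  by (induction "is" arbitrary: x) auto

text \<open>
  A cubic graph on \<open>S\<close>, loops allowed, properly edge-coloured with the colours \<open>0, 1, 2\<close>:
  \<open>s i x\<close> is the other end of the edge of colour \<open>i\<close> at \<open>x\<close>. A walk is the list of its
  colours, and \<open>distinct_adj\<close> says that it never turns back along the edge it has just used, so
  that the last clause says that the girth exceeds \<open>n\<close>. The power of two matters because it is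
  prime to 3.
\<close>

definition colour_graph :: "nat \<Rightarrow> 'a set \<Rightarrow> (nat \<Rightarrow> 'a \<Rightarrow> 'a) \<Rightarrow> bool" where
  "colour_graph n S s \<longleftrightarrow> finite S \<and> (\<exists>k. card S = 2 ^ k) \<and>
     (\<forall>i<3. \<forall>x\<in>S. s i x \<in> S \<and> s i (s i x) = x) \<and>
     (\<forall>x\<in>S. \<forall>is. is \<noteq> [] \<longrightarrow> set is \<subseteq> {..<3} \<longrightarrow> distinct_adj is \<longrightarrow> length is \<le> n
        \<longrightarrow> walk s is x \<noteq> x)"

lemma colour_graph_walk:
  assumes "colour_graph n S s" "x \<in> S" "set is \<subseteq> {..<3}"
  shows "walk s is x \<in> S"
  using assms(2,3) by (induction "is" arbitrary: x) (use assms(1) in \<open>auto simp: colour_graph_def\<close>)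

text \<open>
  Take the cover whose points are pairs of a point \<open>x\<close> and a set \<open>P\<close> of edges, where crossing an
  edge toggles its membership in \<open>P\<close>. Its number of points is again a power of two. A closed walk
  upstairs projects to a closed walk that crosses each edge an even number of times. So the first
  edge is crossed a second time, which cuts off a strictly shorter closed walk downstairs, and
  such a walk is ruled out if the girth downstairs exceeds \<open>n\<close>.
\<close>

lemma colour_graph_cover:
  fixes S :: "nat set"
  assumes S: "colour_graph n S s"
  shows "\<exists>(S' :: nat set) s'. colour_graph (Suc n) S' s'"
proof -
  define edge where "edge = (\<lambda>x i. prod_encode (min x (s i x), i))"
  define E where "E = (\<lambda>(x, i). edge x i) ` (S \<times> {..<3})"
  define flip where "flip = (\<lambda>(P :: nat set) e. if e \<in> P then P - {e} else insert e P)"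
  define t where "t = (\<lambda>i (x, P). (s i x, flip P (edge x i)))"
  \<comment> \<open>Points of the cover are coded as natural numbers, so that the construction can be iterated.\<close>
  define enc where "enc = (\<lambda>(x, P). prod_encode (x, set_encode P))"
  define dec where "dec = (\<lambda>z. (\<lambda>(x, c). (x, set_decode c)) (prod_decode z))"
  define T where "T = S \<times> Pow E"
  define t' where "t' = (\<lambda>i z. enc (t i (dec z)))"
  have finS: "finite S" and inv: "\<And>i x. i < 3 \<Longrightarrow> x \<in> S \<Longrightarrow> s i x \<in> S"
    "\<And>i x. i < 3 \<Longrightarrow> x \<in> S \<Longrightarrow> s i (s i x) = x"
    using S by (auto simp: colour_graph_def)
  obtain k where k: "card S = 2 ^ k" using S by (auto simp: colour_graph_def)
  have girth: "walk s is x \<noteq> x"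
    if "x \<in> S" "is \<noteq> []" "set is \<subseteq> {..<3}" "distinct_adj is" "length is \<le> n" for "is" x
    using S that unfolding colour_graph_def by blast
  have finE: "finite E" using finS by (simp add: E_def)
  have dec_enc: "dec (enc z) = z" if "z \<in> T" for z
    using that finite_subset[OF _ finE]
    by (auto simp: dec_def enc_def T_def split: prod.splits)
  have tT: "t i z \<in> T" if iz: "i < 3" "z \<in> T" for i z
  proof -
    obtain x P where z: "z = (x, P)" "x \<in> S" "P \<subseteq> E" using iz(2) by (auto simp: T_def)
    have "edge x i \<in> E" unfolding E_def using iz z by (intro image_eqI[of _ _ "(x, i)"]) auto
    then show ?thesis using z inv(1) iz by (auto simp: t_def T_def flip_def)
  qed
  have tt: "t i (t i z) = z" if "i < 3" "z \<in> T" for i z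
  proof -
    have "flip (flip P e) e = P" for P e by (auto simp: flip_def)
    moreover have "edge (s i x) i = edge x i" if "x \<in> S" for x
      using inv(2)[OF \<open>i < 3\<close> that] by (simp add: edge_def min.commute)
    ultimately show ?thesis using that inv by (auto simp: t_def T_def)
  qed
  have walkT: "walk t is z \<in> T" if "set is \<subseteq> {..<3}" "z \<in> T" for "is" z
    using that by (induction "is" arbitrary: z) (auto simp: tT)
  have walk_fst: "fst (walk t is z) = walk s is (fst z)" for "is" z
    by (induction "is" arbitrary: z) (auto simp: t_def split: prod.splits)
  have walk_t': "walk t' is (enc z) = enc (walk t is z)" if "set is \<subseteq> {..<3}" "z \<in> T" for "is" z
    using that by (induction "is" arbitrary: z) (auto simp: t'_def dec_enc tT)
  \<comment> \<open>Membership of an edge that is never crossed does not change.\<close>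
  have stays: "e \<in> snd (walk t is z) \<longleftrightarrow> e \<in> snd z"
    if "\<And>ks i ls. is = ks @ i # ls \<Longrightarrow> edge (walk s ks (fst z)) i \<noteq> e" for "is" z e
    using that
  proof (induction "is" arbitrary: z)
    case Nil
    then show ?case by simp
  next
    case (Cons j js)
    have "edge (fst z) j \<noteq> e" using Cons.prems[of "[]" j js] by simp
    moreover have "e \<in> snd (walk t js (t j z)) \<longleftrightarrow> e \<in> snd (t j z)"
    proof (rule Cons.IH)
      fix ks i ls assume "js = ks @ i # ls"
      then show "edge (walk s ks (fst (t j z))) i \<noteq> e"
        using Cons.prems[of "j # ks" i ls] by (auto simp: t_def split: prod.splits)
    qed
    ultimately show ?case by (auto simp: t_def flip_def split: prod.splits)
  qed
  have open_walk: "walk t is z \<noteq> z"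
    if z: "z \<in> T" and "is": "is \<noteq> []" "set is \<subseteq> {..<3}" "distinct_adj is" "length is \<le> Suc n" for "is" z
  proof -
    obtain x P where zx: "z = (x, P)" "x \<in> S" using z by (auto simp: T_def)
    obtain i js where ij: "is = i # js" using "is" by (cases "is") auto
    have i: "i < 3" "s i x \<in> S" using ij "is" inv zx by auto
    \<comment> \<open>The first edge of a short walk is never crossed again, in either direction.\<close>
    have new: "edge (walk s ks (fst (t i z))) j \<noteq> edge x i" if js: "js = ks @ j # ls" for ks j ls
    proof
      assume "edge (walk s ks (fst (t i z))) j = edge x i"
      then have eq: "min (walk s ks (s i x)) (s j (walk s ks (s i x))) = min x (s i x)" and "j = i"
        by (auto simp: edge_def t_def zx)
      let ?y = "walk s ks (s i x)"
      have y: "?y \<in> S" using js ij "is"(2) i by (intro colour_graph_walk[OF S]) auto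
      \<comment> \<open>An edge is crossed from one of its two ends.\<close>
      have "?y = x \<or> ?y = s i x"
        using eq inv(2)[OF i(1) y] inv(2)[OF i(1) zx(2)] \<open>j = i\<close> by (metis min_def)
      then show False
      proof
        assume "?y = x"
        moreover have "distinct_adj (i # ks)"
          using "is"(3) js ij distinct_adj_appendD1[of "i # ks"] by simp
        ultimately show False using girth[of x "i # ks"] zx(2) "is" js ij by auto
      next
        assume "?y = s i x"
        moreover have "ks \<noteq> []" using "is"(3) js ij \<open>j = i\<close> by auto
        moreover have "distinct_adj ks"
          using "is"(3) js ij by (cases ks) (auto simp: distinct_adj_append_iff distinct_adj_Cons)
        ultimately show False using girth[of "s i x" ks] i "is" js ij by auto
      qed
    qed
    have "edge x i \<in> snd (walk t js (t i z)) \<longleftrightarrow> edge x i \<in> snd (t i z)"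
      using stays new by metis
    then show ?thesis by (auto simp: ij zx t_def flip_def split: if_splits)
  qed
  have inj: "inj_on enc T" by (metis dec_enc inj_onI)
  have "colour_graph (Suc n) (enc ` T) t'"
    unfolding colour_graph_def
  proof (intro conjI allI impI ballI)
    show "finite (enc ` T)" using finS finE by (simp add: T_def)
    have "card (enc ` T) = 2 ^ (k + card E)"
      unfolding card_image[OF inj]
      using finS finE by (simp add: T_def card_cartesian_product k card_Pow power_add)
    then show "\<exists>k. card (enc ` T) = 2 ^ k" ..
  next
    fix i z' assume "i < (3 :: nat)" "z' \<in> enc ` T"
    then show "t' i z' \<in> enc ` T" "t' i (t' i z') = z'"
      by (auto simp: t'_def dec_enc tT tt)
  next
    fix z' "is" assume z': "z' \<in> enc ` T" and
      "is": "is \<noteq> []" "set is \<subseteq> {..<3 :: nat}" "distinct_adj is" "length is \<le> Suc n"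
    then obtain z where "z' = enc z" "z \<in> T" by blast
    then show "walk t' is z' \<noteq> z'"
      using open_walk "is" walk_t' walkT inj_onD[OF inj] by metis
  qed
  then show ?thesis by blast
qed

text \<open>
  The iteration starts with a single point that carries three loops.
\<close>

lemma colour_graph_exists: "\<exists>(S :: nat set) s. colour_graph n S s"
proof (induction n)
  case 0
  have "colour_graph 0 {0 :: nat} (\<lambda>i x. x)"
    by (auto simp: colour_graph_def intro: exI[of _ 0])
  then show ?case by blast
next
  case (Suc n)
  then show ?case using colour_graph_cover by blast
qed

section \<open>Exactly-one colourings of hypergraphs\<close>

definition exactly_one :: "'a set set \<Rightarrow> ('a \<Rightarrow> bool) \<Rightarrow> bool" where
  "exactly_one F f \<longleftrightarrow> (\<forall>e\<in>F. \<exists>!x. x \<in> e \<and> f x)"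

text \<open>
  Acyclicity of a family of edges: every nonempty subfamily has an edge that meets the union
  of the other edges in at most one point, so the family can be dismantled edge by edge.
\<close>

definition leafy :: "'a set set \<Rightarrow> bool" where
  "leafy F \<longleftrightarrow> (\<forall>G\<subseteq>F. G \<noteq> {} \<longrightarrow> (\<exists>e\<in>G. \<exists>s. e \<inter> \<Union>(G - {e}) \<subseteq> {s}))"

lemma leafy_subset: "leafy F \<Longrightarrow> G \<subseteq> F \<Longrightarrow> leafy G"
  unfolding leafy_def by (meson subset_trans)

text \<open>
  An acyclic family can be coloured with any prescribed values at two points, except that
  two points of one edge cannot both be true. Remove an edge that is attached to the others in at
  most one point \<open>s\<close>: the colouring of the rest then extends to its two other points, whatever the
  value at \<open>s\<close> is. If one of the prescribed points is among these two, the value at \<open>s\<close> has to be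
  prescribed instead. A false value at \<open>s\<close> is compatible with every other prescription.
\<close>

lemma leafy_colouring:
  assumes "finite F" "leafy F" "\<forall>e\<in>F. card e = 3"
    and "u = v \<longrightarrow> \<alpha> = \<beta>" "\<alpha> \<longrightarrow> \<beta> \<longrightarrow> u \<noteq> v \<longrightarrow> \<not> (\<exists>e\<in>F. u \<in> e \<and> v \<in> e)"
  shows "\<exists>f. f u = \<alpha> \<and> f v = \<beta> \<and> exactly_one F f"
  using assms
proof (induction F arbitrary: u v \<alpha> \<beta> rule: finite_psubset_induct)
  case (psubset F)
  show ?case
  proof (cases "F = {}")
    case True
    then show ?thesis using psubset.prems
      by (intro exI[of _ "\<lambda>w. if w = u then \<alpha> else \<beta>"]) (auto simp: exactly_one_def)
  next
    case False
    then obtain e s0 where e: "e \<in> F" "e \<inter> \<Union>(F - {e}) \<subseteq> {s0}"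
      using psubset.prems(1)[unfolded leafy_def, rule_format, OF subset_refl] by metis
    define G where "G = F - {e}"
    have G: "G \<subset> F" "leafy G" "\<forall>e\<in>G. card e = 3"
      using psubset.prems(1,2) e(1) leafy_subset[of F G] by (auto simp: G_def)
    note IH = psubset.IH[OF G]
    have c3: "card e = 3" using psubset.prems(2) e(1) by blast
    obtain s where s: "s \<in> e" "e \<inter> \<Union>G \<subseteq> {s}"
    proof (cases "s0 \<in> e")
      case True
      then show ?thesis using that e by (auto simp: G_def)
    next
      case False
      obtain s where "s \<in> e" using c3 by fastforce
      then show ?thesis using that False e by (auto simp: G_def)
    qed
    have "card (e - {s}) = 2" using c3 s by simp
    then obtain x0 y0 where xy0: "e - {s} = {x0, y0}" "x0 \<noteq> y0" by (auto simp: card_2_iff)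
    \<comment> \<open>Extension to the two free points with values \<open>a\<close> and \<open>b\<close>, which fix the value at \<open>s\<close>.\<close>
    have ext: "\<exists>g. exactly_one F g \<and> g x = a \<and> g y = b \<and> (\<forall>z. z \<notin> {x, y} \<longrightarrow> g z = f z)"
      if f: "exactly_one G f" "f s \<longleftrightarrow> \<not> a \<and> \<not> b" "\<not> (a \<and> b)"
        and xy: "e = {s, x, y}" "x \<noteq> y" "s \<noteq> x" "s \<noteq> y" for f x y a b
    proof -
      define g where "g = f(x := a, y := b)"
      have g: "g x = a" "g y = b" "\<And>z. z \<notin> {x, y} \<Longrightarrow> g z = f z"
        using xy(2) by (auto simp: g_def)
      have "g s \<longleftrightarrow> \<not> a \<and> \<not> b" using g(3)[of s] f(2) xy by simp
      then have "\<exists>!z. z \<in> e \<and> g z"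
        unfolding xy(1) using g(1,2) f(3) xy(2-4) by (cases a; cases b) auto
      moreover have "\<exists>!z. z \<in> e' \<and> g z" if "e' \<in> G" for e'
      proof -
        have "x \<notin> e'" "y \<notin> e'" using s xy that by auto
        then have "z \<in> e' \<and> g z \<longleftrightarrow> z \<in> e' \<and> f z" for z using g(3)[of z] by auto
        then show ?thesis using f(1) that by (simp add: exactly_one_def)
      qed
      moreover have "F = insert e G" using e(1) by (auto simp: G_def)
      ultimately have "exactly_one F g" by (simp add: exactly_one_def)
      then show ?thesis using g by blast
    qed
    have one: "\<exists>f. f s = c \<and> exactly_one G f" for c
      using IH[of s s c c] by blast
    have two: "\<exists>f. f s = False \<and> f w = c \<and> exactly_one G f" if "w \<noteq> s" for w c
      using IH[of s w False c] that by blast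
    \<comment> \<open>The case that one of the prescribed points is a free point \<open>x\<close> of the removed edge.\<close>
    have leaf: "\<exists>f. f x = a \<and> f w = c \<and> exactly_one F f"
      if xy: "e = {s, x, y}" "x \<noteq> y" "s \<noteq> x" "s \<noteq> y"
        and w: "w = x \<longrightarrow> a = c" "a \<longrightarrow> c \<longrightarrow> w \<noteq> x \<longrightarrow> w \<notin> e" for x y w a c
    proof -
      consider "w = x" | "w = y" | "w = s" | "w \<notin> e" using xy(1) by blast
      then show ?thesis
      proof cases
        case 1
        obtain f where f: "f s = False" "exactly_one G f" using one by blast
        obtain g where "exactly_one F g" "g x = a" using ext[OF f(2) _ _ xy, of a "\<not> a"] f(1) by auto
        then show ?thesis using 1 w(1) by blast
      next
        case 2
        obtain f where f: "f s = (\<not> a \<and> \<not> c)" "exactly_one G f" using one by blast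
        have "\<not> (a \<and> c)" using 2 w(2) xy by auto
        then obtain g where "exactly_one F g" "g x = a" "g y = c"
          using ext[OF f(2) _ _ xy, of a c] f(1) by auto
        then show ?thesis using 2 by blast
      next
        case 3
        obtain f where f: "f s = c" "exactly_one G f" using one by blast
        have "\<not> (a \<and> c)" using 3 w(2) xy by auto
        then obtain g where "exactly_one F g" "g x = a" "g s = f s"
          using ext[OF f(2) _ _ xy, of a "\<not> a \<and> \<not> c"] f(1) xy by auto
        then show ?thesis using 3 f(1) by blast
      next
        case 4
        then have w: "w \<notin> {x, y}" "w \<noteq> s" using xy(1) by auto
        obtain f where f: "f s = False" "f w = c" "exactly_one G f" using two[OF w(2)] by blast
        obtain g where "exactly_one F g" "g x = a" "g w = f w"
          using ext[OF f(3) _ _ xy, of a "\<not> a"] f(1) w(1) by auto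
        then show ?thesis using f(2) by blast
      qed
    qed
    have xy: "e = {s, x0, y0}" "e = {s, y0, x0}" "s \<noteq> x0" "s \<noteq> y0" using xy0 s(1) by auto
    consider "u \<in> {x0, y0}" | "v \<in> {x0, y0}" | "u \<notin> {x0, y0}" "v \<notin> {x0, y0}" by blast
    then show ?thesis
    proof cases
      case 1
      then have "u \<in> e" using xy(1) by blast
      then have v: "v = u \<longrightarrow> \<alpha> = \<beta>" "\<alpha> \<longrightarrow> \<beta> \<longrightarrow> v \<noteq> u \<longrightarrow> v \<notin> e"
        using psubset.prems(3,4) e(1) by blast+
      from 1 consider "u = x0" | "u = y0" by blast
      then show ?thesis
      proof cases
        case 1
        show ?thesis using leaf[OF xy(1) xy0(2) xy(3,4) v[unfolded 1]] 1 by simp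
      next
        case 2
        show ?thesis using leaf[OF xy(2) xy0(2)[symmetric] xy(4,3) v[unfolded 2]] 2 by simp
      qed
    next
      case 2
      then have "v \<in> e" using xy(1) by blast
      then have u: "u = v \<longrightarrow> \<beta> = \<alpha>" "\<beta> \<longrightarrow> \<alpha> \<longrightarrow> u \<noteq> v \<longrightarrow> u \<notin> e"
        using psubset.prems(3,4) e(1) by blast+
      from 2 consider "v = x0" | "v = y0" by blast
      then show ?thesis
      proof cases
        case 1
        show ?thesis using leaf[OF xy(1) xy0(2) xy(3,4) u[unfolded 1]] 1 by auto
      next
        case 2
        show ?thesis using leaf[OF xy(2) xy0(2)[symmetric] xy(4,3) u[unfolded 2]] 2 by auto
      qed
    next
      case 3
      obtain f where f: "f u = \<alpha>" "f v = \<beta>" "exactly_one G f"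
        using IH[of u v \<alpha> \<beta>] psubset.prems(3,4) unfolding G_def by blast
      obtain g where "exactly_one F g" "g u = f u" "g v = f v"
        using ext[OF f(3) _ _ xy(1) xy0(2) xy(3,4), of "\<not> f s" False] 3 by auto
      then show ?thesis using f by blast
    qed
  qed
qed

definition locally_leafy :: "nat \<Rightarrow> 'a set set \<Rightarrow> bool" where
  "locally_leafy K H \<longleftrightarrow> (\<forall>F\<subseteq>H. finite F \<longrightarrow> card F \<le> K \<longrightarrow> leafy F)"

lemma locally_leafy_linear:
  assumes "locally_leafy K H" "2 \<le> K" "e \<in> H" "e' \<in> H" "{u, v} \<subseteq> e" "{u, v} \<subseteq> e'" "u \<noteq> v"
  shows "e = e'"
proof (rule ccontr)
  assume "e \<noteq> e'"
  have "leafy {e, e'}"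
    using assms(1-4) card_insert_le_m1[of 2 "{e'}" e] unfolding locally_leafy_def by auto
  then obtain d s where d: "d \<in> {e, e'}" "d \<inter> \<Union>({e, e'} - {d}) \<subseteq> {s}"
    unfolding leafy_def by (metis insert_not_empty subset_refl)
  then have "{u, v} \<subseteq> {s}" using \<open>e \<noteq> e'\<close> assms(5,6) by auto
  then show False using assms(7) by auto
qed

text \<open>
  The edges are the neighbourhoods of the points in a coloured cubic graph. Each point lies in
  exactly three of the sets \<open>{s 0 x, s 1 x, s 2 x}\<close>, so double counting shows that a set which
  meets each of them in exactly one point has one third of the number of points as its size. This
  number is a power of two, so no such set exists. On the other hand, a small family without a
  loosely attached edge would allow a walk from neighbourhood to neighbourhood that never turns
  back, and by the pigeonhole principle it would contain a closed walk that is too short.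
\<close>

lemma leafy_hypergraph_exists:
  "\<exists>H :: nat set set. finite H \<and> H \<noteq> {} \<and> (\<forall>e\<in>H. card e = 3) \<and> locally_leafy K H \<and> (\<nexists>f. exactly_one H f)"
proof -
  \<comment> \<open>The summand 2 excludes double edges, so that each neighbourhood has three points.\<close>
  obtain S :: "nat set" and s where S: "colour_graph (2 * K + 2) S s"
    using colour_graph_exists by blast
  have finS: "finite S" and inv: "\<And>i x. i < 3 \<Longrightarrow> x \<in> S \<Longrightarrow> s i x \<in> S"
    "\<And>i x. i < 3 \<Longrightarrow> x \<in> S \<Longrightarrow> s i (s i x) = x"
    using S by (auto simp: colour_graph_def)
  obtain k where k: "card S = 2 ^ k" using S by (auto simp: colour_graph_def)
  have girth: "walk s is x \<noteq> x"
    if "x \<in> S" "is \<noteq> []" "set is \<subseteq> {..<3}" "distinct_adj is" "length is \<le> 2 * K + 2" for "is" x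
    using S that unfolding colour_graph_def by blast
  have neq: "s i x \<noteq> s j x" if "x \<in> S" "i < 3" "j < 3" "i \<noteq> j" for i j x
    using girth[of "s i x" "[i, j]"] inv that by auto
  define edge where "edge = (\<lambda>x. (\<lambda>i. s i x) ` {..<3})"
  have inj3: "inj_on (\<lambda>i. s i x) {..<3}" if "x \<in> S" for x
    using neq that by (intro inj_onI) auto
  have bij: "bij_betw (s i) S S" if "i < 3" for i
    using that inv by (intro bij_betw_byWitness[of _ "s i"]) auto
  have "\<not> exactly_one (edge ` S) f" for f
  proof
    assume f: "exactly_one (edge ` S) f"
    have one: "(\<Sum>i<3. if f (s i x) then 1 else 0) = (1 :: nat)" if "x \<in> S" for x
    proof -
      obtain y where y: "y \<in> edge x" "f y" "\<And>z. z \<in> edge x \<Longrightarrow> f z \<Longrightarrow> z = y"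
        using f \<open>x \<in> S\<close> unfolding exactly_one_def by (metis image_eqI)
      have "(\<Sum>i<3. if f (s i x) then 1 else 0) = (\<Sum>z\<in>edge x. if f z then 1 else (0 :: nat))"
        unfolding edge_def by (simp add: sum.reindex[OF inj3[OF that]])
      also have "\<dots> = (\<Sum>z\<in>edge x. if z = y then 1 else 0)"
      proof (rule sum.cong[OF refl])
        fix z assume "z \<in> edge x"
        then have "f z \<longleftrightarrow> z = y" using y(2,3) by blast
        then show "(if f z then 1 else 0) = (if z = y then 1 else (0 :: nat))" by simp
      qed
      also have "\<dots> = 1" using y(1) by (simp add: edge_def)
      finally show ?thesis .
    qed
    have "card S = (\<Sum>x\<in>S. \<Sum>i<3. if f (s i x) then 1 else 0)" using one by simp
    also have "\<dots> = (\<Sum>i<3. \<Sum>x\<in>S. if f (s i x) then 1 else 0)" by (rule sum.swap)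
    also have "\<dots> = (\<Sum>i<(3::nat). \<Sum>x\<in>S. if f x then 1 else 0)"
    proof (rule sum.cong[OF refl])
      fix i :: nat assume "i \<in> {..<3}"
      then show "(\<Sum>x\<in>S. if f (s i x) then 1 else 0) = (\<Sum>x\<in>S. if f x then 1 else 0)"
        using sum.reindex_bij_betw[OF bij[of i], of "\<lambda>x. if f x then 1 else 0"] by simp
    qed
    also have "\<dots> = 3 * (\<Sum>x\<in>S. if f x then 1 else 0)" by simp
    finally have "3 dvd (2 :: nat) ^ k" using k by simp
    moreover have "coprime (3 :: nat) (2 ^ k)" by simp
    ultimately show False using coprime_absorb_left[of "3 :: nat" "2 ^ k"] by simp
  qed
  moreover have "locally_leafy K (edge ` S)"
    unfolding locally_leafy_def leafy_def
  proof (intro allI impI, rule ccontr)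
    fix F G
    assume F: "F \<subseteq> edge ` S" "finite F" "card F \<le> K" "G \<subseteq> F" "G \<noteq> {}"
      and no: "\<not> (\<exists>e\<in>G. \<exists>v. e \<inter> \<Union>(G - {e}) \<subseteq> {v})"
    obtain R where R: "R \<subseteq> S" "inj_on edge R" "G = edge ` R"
      using F(1,4) by (metis subset_image_inj subset_trans)
    have cardR: "card R \<le> K" "finite R"
      using F(3) card_mono[OF F(2,4)] R(3) card_image[OF R(2)] finite_subset[OF R(1) finS] by auto
    \<comment> \<open>From the neighbourhood of \<open>x\<close>, entered by an edge of colour \<open>j\<close>, another one can be reached in two
      steps of different colours, the first of which is not \<open>j\<close>.\<close>
    have step: "\<exists>i l. i < 3 \<and> l < 3 \<and> i \<noteq> j \<and> i \<noteq> l \<and> walk s [i, l] x \<in> R"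
      if "x \<in> R" for x j
    proof -
      have "\<not> edge x \<inter> \<Union>(G - {edge x}) \<subseteq> {s j x}" using no that R(3) by blast
      then obtain v e where "v \<in> edge x" "v \<noteq> s j x" "v \<in> e" "e \<in> G" "e \<noteq> edge x" by blast
      then obtain y where v: "v \<in> edge x" "v \<in> edge y" "v \<noteq> s j x" "y \<in> R" "edge y \<noteq> edge x"
        using R(3) by blast
      then obtain i l where il: "i < 3" "l < 3" "v = s i x" "v = s l y"
        using v(1,2) unfolding edge_def image_iff lessThan_iff by blast
      have xy: "x \<in> S" "y \<in> S" using R that v by auto
      have "walk s [i, l] x = y" using il inv(2)[of l y] xy by (metis walk.simps)
      moreover have "i \<noteq> l" using il inv(2)[of i x] inv(2)[of l y] xy v(5) by auto
      moreover have "i \<noteq> j" using il(3) v(3) by auto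
      ultimately show ?thesis using il(1,2) v(4) by blast
    qed
    obtain x0 where x0: "x0 \<in> R" using F(5) R by auto
    \<comment> \<open>A state \<open>(x, i, l)\<close> consists of a centre and of the colours of the next two steps.\<close>
    define ok where "ok = (\<lambda>z :: nat \<times> nat \<times> nat. fst z \<in> R \<and> fst (snd z) < 3 \<and> snd (snd z) < 3
      \<and> fst (snd z) \<noteq> snd (snd z) \<and> walk s [fst (snd z), snd (snd z)] (fst z) \<in> R)"
    define nxt where "nxt = (\<lambda>(z :: nat \<times> nat \<times> nat) (z' :: nat \<times> nat \<times> nat). fst z' = walk s [fst (snd z), snd (snd z)] (fst z)
      \<and> fst (snd z') \<noteq> snd (snd z))"
    have "\<exists>z. \<forall>m. ok (z m) \<and> nxt (z m) (z (Suc m))"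
    proof (rule dependent_nat_choice)
      have ok: "\<exists>z. ok z \<and> fst z = x \<and> fst (snd z) \<noteq> j" if x: "x \<in> R" for x j
      proof -
        obtain i l where "i < 3" "l < 3" "i \<noteq> j" "i \<noteq> l" "walk s [i, l] x \<in> R"
          using step[OF x] by blast
        then show ?thesis using x by (intro exI[of _ "(x, i, l)"]) (simp add: ok_def)
      qed
      show "\<exists>z. ok z" using ok[OF x0] by blast
      fix z :: "nat \<times> nat \<times> nat" and m :: nat assume "ok z"
      then show "\<exists>z'. ok z' \<and> nxt z z'" unfolding nxt_def using ok by (simp add: ok_def)
    qed
    then obtain z where z: "\<And>m. ok (z m)" "\<And>m. nxt (z m) (z (Suc m))" by blast
    \<comment> \<open>The colours of the walk from stage \<open>a\<close> to stage \<open>a + d\<close>.\<close>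
    define w where "w = (\<lambda>a d. concat (map (\<lambda>m. [fst (snd (z m)), snd (snd (z m))]) [a..<a + d]))"
    have w: "walk s (w a d) (fst (z a)) = fst (z (a + d)) \<and> set (w a d) \<subseteq> {..<3} \<and> distinct_adj (w a d)
        \<and> length (w a d) = 2 * d \<and> (d > 0 \<longrightarrow> last (w a d) = snd (snd (z (a + d - 1))))" for a d
    proof (induction d)
      case 0
      then show ?case by (simp add: w_def)
    next
      case (Suc d)
      have eq: "w a (Suc d) = w a d @ [fst (snd (z (a + d))), snd (snd (z (a + d)))]"
        by (simp add: w_def)
      have "d > 0 \<Longrightarrow> fst (snd (z (a + d))) \<noteq> snd (snd (z (a + d - 1)))"
        using z(2)[of "a + d - 1"] by (simp add: nxt_def)
      moreover have "w a d \<noteq> [] \<Longrightarrow> d > 0" by (cases d) (simp_all add: w_def)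
      ultimately show ?case
        using Suc z[of "a + d"] unfolding eq
        by (auto simp: walk_append distinct_adj_append_iff ok_def nxt_def)
    qed
    have "\<not> inj_on (\<lambda>m. fst (z m)) {..card R}"
    proof
      assume "inj_on (\<lambda>m. fst (z m)) {..card R}"
      then have "card {..card R} \<le> card R"
        using z(1) cardR by (intro card_inj_on_le[of "\<lambda>m. fst (z m)"]) (auto simp: ok_def)
      then show False by simp
    qed
    then obtain a b where "fst (z a) = fst (z b)" "a \<noteq> b" "a \<le> card R" "b \<le> card R"
      unfolding inj_on_def by auto
    then obtain a b where ab: "fst (z a) = fst (z b)" "a < b" "b \<le> card R"
      by (metis linorder_neqE_nat)
    have "fst (z a) \<in> S" using z(1)[of a] R(1) by (auto simp: ok_def)
    moreover have "w a (b - a) \<noteq> []" using w[of a "b - a"] ab(2) by auto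
    moreover have "2 * (b - a) \<le> 2 * K + 2" using ab(3) cardR(1) by linarith
    ultimately show False using w[of a "b - a"] girth[of "fst (z a)" "w a (b - a)"] ab by simp
  qed
  moreover have "card e = 3" if "e \<in> edge ` S" for e
    using that card_image[OF inj3] by (auto simp: edge_def)
  moreover have "S \<noteq> {}" using k by auto
  ultimately show ?thesis using finS by (intro exI[of _ "edge ` S"]) auto
qed

section \<open>The algebra of a hypergraph\<close>

text \<open>
  The element \<open>Atom\<close> plays the role of \<open>a\<close>, and \<open>Top\<close> that of \<open>\<infinity>\<close>. The vertices of the hypergraph
  are generators, subject to the relation that the product of the three vertices of an edge is
  \<open>Atom\<close>. If exactly one vertex of each edge has the value \<open>a\<close> and the others are 1, then the product of
  two vertices of an edge is \<open>a\<close> when the third vertex \<open>w\<close> is 1, and 1 when \<open>w\<close> is \<open>a\<close>, whichever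
  edge through \<open>w\<close> is taken. Hence all these products are identified with one complement
  \<open>Covert w\<close>. Products not forced by the edges are \<open>Top\<close>.
\<close>

datatype elem = Zero_el | One_el | Atom | Top | Vert nat | Covert nat

definition third :: "nat set set \<Rightarrow> nat \<Rightarrow> nat \<Rightarrow> nat" where
  "third H u v = (SOME w. {u, v, w} \<in> H)"

definition vert_times :: "nat set set \<Rightarrow> nat \<Rightarrow> nat \<Rightarrow> elem" where
  "vert_times H u v = (if {u, v, third H u v} \<in> H then Covert (third H u v) else Top)"

definition elem_plus :: "elem \<Rightarrow> elem \<Rightarrow> elem" where
  "elem_plus x y = (if x = Zero_el then y else if y = Zero_el \<or> x = y then x else Top)"

fun elem_times :: "nat set set \<Rightarrow> elem \<Rightarrow> elem \<Rightarrow> elem" where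
  "elem_times H Zero_el y = Zero_el"
| "elem_times H x Zero_el = Zero_el"
| "elem_times H One_el y = y"
| "elem_times H x One_el = x"
| "elem_times H (Vert u) (Vert v) = vert_times H u v"
| "elem_times H (Vert u) (Covert v) = (if u = v then Atom else Top)"
| "elem_times H (Covert u) (Vert v) = (if u = v then Atom else Top)"
| "elem_times H _ _ = Top"

definition elem_copy :: "elem \<Rightarrow> elem \<Rightarrow> elem" where
  "elem_copy x y = (if x = Zero_el \<or> y = Zero_el \<or> x = One_el \<and> y = One_el then One_el else Top)"

definition elem_exp :: "elem \<Rightarrow> elem" where
  "elem_exp x = (if x = Zero_el \<or> x = One_el then One_el else Top)"

definition hyper_alg :: "nat set set \<Rightarrow> elem alg" where
  "hyper_alg H = \<lparr>car = UNIV, plus_op = elem_plus, times_op = elem_times H, copy_op = elem_copy,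
     fact_op = elem_exp, exp2_op = elem_exp, zero_op = Zero_el, one_op = One_el\<rparr>"

lemma hyper_alg_simps [simp]:
  "car (hyper_alg H) = UNIV" "plus_op (hyper_alg H) = elem_plus"
  "times_op (hyper_alg H) = elem_times H" "copy_op (hyper_alg H) = elem_copy"
  "fact_op (hyper_alg H) = elem_exp" "exp2_op (hyper_alg H) = elem_exp"
  "zero_op (hyper_alg H) = Zero_el" "one_op (hyper_alg H) = One_el"
  by (simp_all add: hyper_alg_def)

lemma algebra_of_hyper_alg: "algebra_of \<tau> (hyper_alg H)"
  by (simp add: algebra_of_def)

lemma S70_simps [simp]:
  "car S70 = UNIV" "plus_op S70 = s7_plus" "times_op S70 = s7_times" "copy_op S70 = s7_copy"
  "fact_op S70 = s7_fact" "exp2_op S70 = s7_exp2" "zero_op S70 = E0" "one_op S70 = E1"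
  by (simp_all add: S70_def)

lemma s7_plus_eq_E0 [simp]: "s7_plus x y = E0 \<longleftrightarrow> x = E0 \<and> y = E0"
  by (cases x; cases y; simp)

lemma s7_times_eq_E0 [simp]: "s7_times x y = E0 \<longleftrightarrow> x = E0 \<or> y = E0"
  by (cases x; cases y; simp)

lemma s7_copy_fact_exp2_neq_E0 [simp]: "s7_copy x y \<noteq> E0" "s7_fact x \<noteq> E0" "s7_exp2 x \<noteq> E0"
  by (cases x; cases y; simp)+

lemma s7_times_unit [simp]: "s7_times x E0 = E0" "s7_times E1 x = x" "s7_times x E1 = x"
  by (cases x; simp)+

lemma s7_Einf_simps [simp]:
  "s7_plus x Einf = Einf" "s7_plus Einf x = Einf"
  "x \<noteq> E0 \<Longrightarrow> s7_times x Einf = Einf" "x \<noteq> E0 \<Longrightarrow> s7_times Einf x = Einf"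
  "x \<noteq> E0 \<Longrightarrow> s7_copy x Einf = Einf" "x \<noteq> E0 \<Longrightarrow> s7_copy Einf x = Einf"
  by (cases x; simp)+

lemma s7_plus_E0 [simp]: "s7_plus x E0 = x"
  by (cases x; simp)

lemma s7_plus_idem [simp]: "s7_plus x x = x"
  by (cases x; simp)

lemma elem_times_unit [simp]:
  "elem_times H x Zero_el = Zero_el" "elem_times H One_el x = x" "elem_times H x One_el = x"
  by (cases x; simp)+

lemma vert_times_neq [simp]:
  "vert_times H u v \<noteq> Zero_el" "vert_times H u v \<noteq> One_el" "vert_times H u v \<noteq> Vert w"
  by (simp_all add: vert_times_def)

lemma elem_times_eq_Zero [simp]: "elem_times H x y = Zero_el \<longleftrightarrow> x = Zero_el \<or> y = Zero_el"
  by (cases x; cases y; simp)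

lemma elem_plus_eq_Zero [simp]: "elem_plus x y = Zero_el \<longleftrightarrow> x = Zero_el \<and> y = Zero_el"
  by (auto simp: elem_plus_def)

text \<open>
  A colouring \<open>f\<close> interprets the elements in \<open>S70\<close>: a true vertex becomes \<open>a\<close> and a false one becomes
  1. This is not a homomorphism, since products that are \<open>Top\<close> may become smaller.
\<close>

fun transl :: "(nat \<Rightarrow> bool) \<Rightarrow> elem \<Rightarrow> s7" where
  "transl f Zero_el = E0"
| "transl f One_el = E1"
| "transl f Atom = Ea"
| "transl f Top = Einf"
| "transl f (Vert u) = (if f u then Ea else E1)"
| "transl f (Covert u) = (if f u then E1 else Ea)"

lemma transl_eq_E0 [simp]: "transl f x = E0 \<longleftrightarrow> x = Zero_el"
  by (cases x) auto

lemma elem_plus_not_Top: "elem_plus x y \<noteq> Top \<Longrightarrow> x \<noteq> Top \<and> y \<noteq> Top"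
  by (auto simp: elem_plus_def split: if_splits)

lemma transl_plus:
  "elem_plus x y \<noteq> Top \<Longrightarrow> transl f (elem_plus x y) = s7_plus (transl f x) (transl f y)"
  by (auto simp: elem_plus_def split: if_splits)

text \<open>
  The edges that decide the products of two vertices from \<open>U\<close>.
\<close>

definition near :: "nat set set \<Rightarrow> nat set \<Rightarrow> nat set set" where
  "near H U = {e \<in> H. \<exists>u\<in>U. \<exists>v\<in>U. e = {u, v, third H u v}}"

lemma third_edge: "{u, v, w} \<in> H \<Longrightarrow> {u, v, third H u v} \<in> H"
  unfolding third_def by (rule someI)

lemma near_small:
  assumes "finite U"
  shows "finite (near H U)" "card (near H U) \<le> card U * card U"
proof -
  have sub: "near H U \<subseteq> (\<lambda>(u, v). {u, v, third H u v}) ` (U \<times> U)"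
    by (auto simp: near_def)
  then show "finite (near H U)" using assms by (meson finite_SigmaI finite_imageI finite_subset)
  have "card (near H U) \<le> card (U \<times> U)"
    by (rule surj_card_le[OF _ sub]) (simp add: assms)
  then show "card (near H U) \<le> card U * card U" by (simp add: card_cartesian_product)
qed

primrec vars :: "trm \<Rightarrow> nat set" where
  "vars (Var n) = {n}"
| "vars Zero = {}"
| "vars One = {}"
| "vars (Plus s t) = vars s \<union> vars t"
| "vars (Times s t) = vars s \<union> vars t"
| "vars (Copy s t) = vars s \<union> vars t"
| "vars (Fact t) = vars t"
| "vars (Exp2 t) = vars t"

lemma finite_vars: "finite (vars t)"
  by (induction t) auto

text \<open>
  Since \<open>transl f\<close> maps nonzero elements to nonzero elements, the nonzero elements are closed
  under all operations on both sides, and whether a term vanishes does not depend on the colouring.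
  This covers the cases in which zero absorbs \<open>Top\<close>.
\<close>

lemma eval_eq_Zero_iff:
  "eval (hyper_alg H) v t = Zero_el \<longleftrightarrow> eval S70 (\<lambda>n. transl f (v n)) t = E0"
  by (induction t) (auto simp: elem_copy_def elem_exp_def)

section \<open>Evaluation through colourings\<close>

text \<open>
  An evaluation that starts from visible elements produces no vertex outside \<open>U\<close>. Products may
  yield \<open>Covert w\<close> for other \<open>w\<close>, which does no harm: only a product of two vertices needs an edge.
\<close>

definition visible :: "nat set \<Rightarrow> elem \<Rightarrow> bool" where
  "visible U x \<longleftrightarrow> (\<forall>u. x = Vert u \<longrightarrow> u \<in> U)"

lemma visible_times: "visible U x \<Longrightarrow> visible U y \<Longrightarrow> visible U (elem_times H x y)"
  by (cases x; cases y; simp add: visible_def)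

text \<open>
  The situation of a valuation with few variables: only the vertices in \<open>U\<close> occur among its values,
  and the edges relevant for their products form an acyclic family. The translations along the
  colourings of this family jointly determine the values of terms in the algebra.
\<close>

locale local_view =
  fixes H :: "nat set set" and U :: "nat set"
  assumes card3: "e \<in> H \<Longrightarrow> card e = 3"
    and finite_near: "finite (near H U)"
    and leafy_near: "leafy (near H U)"
begin

lemma edge_distinct: "{u, v, w} \<in> H \<Longrightarrow> u \<noteq> v \<and> u \<noteq> w \<and> v \<noteq> w"
  using card3[of "{u, v, w}"] by (auto simp: card_insert_if split: if_splits)

lemma colouring_at2:
  assumes "u = v \<longrightarrow> \<alpha> = \<beta>" "\<alpha> \<longrightarrow> \<beta> \<longrightarrow> u \<noteq> v \<longrightarrow> \<not> (\<exists>e\<in>near H U. u \<in> e \<and> v \<in> e)"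
  shows "\<exists>f. f u = \<alpha> \<and> f v = \<beta> \<and> exactly_one (near H U) f"
  using assms card3 by (intro leafy_colouring[OF finite_near leafy_near]) (simp_all add: near_def)

lemma colouring_at: "\<exists>f. f u = \<alpha> \<and> exactly_one (near H U) f"
  using colouring_at2[of u u \<alpha> \<alpha>] by simp

lemma colouring: "\<exists>f. exactly_one (near H U) f"
  using colouring_at[of 0 True] by blast

lemma colouring_at2_not_both:
  assumes "u = v \<longrightarrow> \<alpha> = \<beta>" "\<not> (\<alpha> \<and> \<beta>)"
  shows "\<exists>f. f u = \<alpha> \<and> f v = \<beta> \<and> exactly_one (near H U) f"
  using colouring_at2[of u v \<alpha> \<beta>] assms by blast

text \<open>
  Any two values at two distinct vertices can be realised, except possibly true and true; this
  exception never prevents a separation.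
\<close>

lemma transl_separates:
  assumes "x \<noteq> y"
  shows "\<exists>f. exactly_one (near H U) f \<and> transl f x \<noteq> transl f y"
proof -
  have const: ?thesis if "\<And>f. transl f x \<noteq> transl f y"
    using colouring that by blast
  show ?thesis
  proof (cases x; cases y)
    fix u v assume "x = Vert u" "y = Vert v"
    then show ?thesis using assms colouring_at2_not_both[of u v True False] by auto
  next
    fix u v assume *: "x = Covert u" "y = Covert v"
    then show ?thesis using assms colouring_at2_not_both[of u v True False] by auto
  next
    fix u v assume *: "x = Vert u" "y = Covert v"
    then show ?thesis using const colouring_at2_not_both[of u v False False] by (cases "u = v") auto
  next
    fix u v assume *: "x = Covert u" "y = Vert v"
    then show ?thesis using const colouring_at2_not_both[of u v False False] by (cases "u = v") auto
  next
    fix u assume "x = Vert u" "y = One_el"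
    then show ?thesis using colouring_at[of u True] by auto
  next
    fix u assume "x = Vert u" "y = Atom"
    then show ?thesis using colouring_at[of u False] by auto
  next
    fix u assume "x = Covert u" "y = One_el"
    then show ?thesis using colouring_at[of u False] by auto
  next
    fix u assume "x = Covert u" "y = Atom"
    then show ?thesis using colouring_at[of u True] by auto
  next
    fix u assume "y = Vert u" "x = One_el"
    then show ?thesis using colouring_at[of u True] by auto
  next
    fix u assume "y = Vert u" "x = Atom"
    then show ?thesis using colouring_at[of u False] by auto
  next
    fix u assume "y = Covert u" "x = One_el"
    then show ?thesis using colouring_at[of u False] by auto
  next
    fix u assume "y = Covert u" "x = Atom"
    then show ?thesis using colouring_at[of u True] by auto
  qed (use assms const in auto)
qed

text \<open>
  Two distinct vertices whose product is \<open>Top\<close> lie in no common edge, so both can be true at once,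
  and \<open>a \<sqdot> a = \<infinity>\<close>. In the other cases where neither factor is \<open>Top\<close>, both factors can be
  translated to \<open>a\<close> without making two distinct vertices true.
\<close>

lemma transl_detects_Top:
  assumes "elem_times H x y = Top"
  shows "\<exists>f. exactly_one (near H U) f \<and> s7_times (transl f x) (transl f y) = Einf"
proof -
  have const: ?thesis if "\<And>f. s7_times (transl f x) (transl f y) = Einf"
    using colouring that by blast
  show ?thesis
  proof (cases x; cases y)
    fix u v assume xy: "x = Vert u" "y = Vert v"
    show ?thesis
    proof (cases "u = v")
      case True
      then show ?thesis using xy colouring_at[of u True] by auto
    next
      case False
      have "\<not> (u \<in> e \<and> v \<in> e)" if "e \<in> H" for e
      proof
        assume uv: "u \<in> e \<and> v \<in> e"
        then have "card (e - {u, v}) = 1" using card3[OF that] False by (simp add: card_Diff_subset)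
        then obtain w where "e - {u, v} = {w}" by (auto simp: card_1_singleton_iff)
        then have "e = {u, v, w}" using uv by blast
        then show False using third_edge[of u v w H] that assms by (simp add: xy vert_times_def)
      qed
      then have "\<not> (\<exists>e\<in>near H U. u \<in> e \<and> v \<in> e)" by (simp add: near_def)
      then obtain f where "exactly_one (near H U) f" "f u = True" "f v = True"
        using colouring_at2[of u v True True] False by auto
      then show ?thesis using xy by auto
    qed
  next
    fix u v assume xy: "x = Vert u" "y = Covert v"
    then show ?thesis using assms colouring_at2_not_both[of u v True False] by (auto split: if_splits)
  next
    fix u v assume xy: "x = Covert u" "y = Vert v"
    then show ?thesis using assms colouring_at2_not_both[of u v False True] by (auto split: if_splits)
  next
    fix u v assume xy: "x = Covert u" "y = Covert v"
    then show ?thesis using colouring_at2_not_both[of u v False False] by auto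
  next
    fix u assume "x = Vert u" "y = Atom"
    then show ?thesis using colouring_at[of u True] by auto
  next
    fix u assume "x = Covert u" "y = Atom"
    then show ?thesis using colouring_at[of u False] by auto
  next
    fix u assume "y = Vert u" "x = Atom"
    then show ?thesis using colouring_at[of u True] by auto
  next
    fix u assume "y = Covert u" "x = Atom"
    then show ?thesis using colouring_at[of u False] by auto
  qed (use assms const in auto)
qed

lemma eval_visible:
  assumes "\<forall>n\<in>vars t. visible U (v n)"
  shows "visible U (eval (hyper_alg H) v t)"
  using assms
proof (induction t)
  case (Times s t)
  then show ?case by (simp add: visible_times)
qed (auto simp: visible_def elem_plus_def elem_copy_def elem_exp_def)

text \<open>
  For two vertices this is the defining property of a colouring at the edge through them.
\<close>

lemma transl_times:
  assumes "exactly_one (near H U) f" "visible U x" "visible U y" "elem_times H x y \<noteq> Top"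
  shows "transl f (elem_times H x y) = s7_times (transl f x) (transl f y)"
proof (cases "\<exists>u v. x = Vert u \<and> y = Vert v")
  case True
  then obtain u v where uv: "x = Vert u" "y = Vert v" by blast
  define w where "w = third H u v"
  have e: "{u, v, w} \<in> H" using assms(4) uv by (auto simp: vert_times_def w_def split: if_splits)
  then have "{u, v, w} \<in> near H U" using assms(2,3) uv by (auto simp: near_def visible_def w_def)
  from assms(1)[unfolded exactly_one_def, rule_format, OF this]
  obtain z where z: "z \<in> {u, v, w} \<and> f z" "\<forall>y. y \<in> {u, v, w} \<and> f y \<longrightarrow> y = z"
    by (elim ex1E)
  have "f u \<longleftrightarrow> u = z" "f v \<longleftrightarrow> v = z" "f w \<longleftrightarrow> w = z" using z by blast+
  then have "transl f (Covert w) = s7_times (transl f (Vert u)) (transl f (Vert v))"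
    using z(1) edge_distinct[OF e] by auto
  then show ?thesis using e uv by (simp add: vert_times_def w_def)
next
  case False
  then show ?thesis using assms(4) by (cases x; cases y; simp split: if_splits)
qed

lemma eval_transl:
  assumes "exactly_one (near H U) f" "\<forall>n\<in>vars t. visible U (v n)" "eval (hyper_alg H) v t \<noteq> Top"
  shows "eval S70 (\<lambda>n. transl f (v n)) t = transl f (eval (hyper_alg H) v t)"
  using assms(2,3)
proof (induction t)
  case (Plus s t)
  let ?x = "eval (hyper_alg H) v s" and ?y = "eval (hyper_alg H) v t"
  have nt: "elem_plus ?x ?y \<noteq> Top" using Plus.prems(2) by simp
  then have "?x \<noteq> Top" "?y \<noteq> Top" using elem_plus_not_Top by blast+
  then show ?case using Plus.IH Plus.prems(1) transl_plus[OF nt] by simp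
next
  case (Times s t)
  let ?x = "eval (hyper_alg H) v s" and ?y = "eval (hyper_alg H) v t"
  have zero: "?x = Zero_el \<longleftrightarrow> eval S70 (\<lambda>n. transl f (v n)) s = E0"
    "?y = Zero_el \<longleftrightarrow> eval S70 (\<lambda>n. transl f (v n)) t = E0"
    by (rule eval_eq_Zero_iff)+
  show ?case
  proof (cases "?x = Zero_el \<or> ?y = Zero_el")
    case True
    then show ?thesis using zero by auto
  next
    case False
    then have "?x \<noteq> Top" "?y \<noteq> Top" using Times.prems(2) by (cases ?x; cases ?y; auto)+
    then show ?thesis
      using Times.IH Times.prems transl_times[OF assms(1), of ?x ?y] by (simp add: eval_visible)
  qed
next
  case (Copy s t)
  let ?x = "eval (hyper_alg H) v s" and ?y = "eval (hyper_alg H) v t"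
  have zero: "?x = Zero_el \<longleftrightarrow> eval S70 (\<lambda>n. transl f (v n)) s = E0"
    "?y = Zero_el \<longleftrightarrow> eval S70 (\<lambda>n. transl f (v n)) t = E0"
    by (rule eval_eq_Zero_iff)+
  show ?case
  proof (cases "?x = Zero_el \<or> ?y = Zero_el")
    case True
    then show ?thesis using zero
      by (cases "eval S70 (\<lambda>n. transl f (v n)) s") (auto simp: elem_copy_def)
  next
    case False
    then have "?x = One_el" "?y = One_el"
      using Copy.prems(2) by (auto simp: elem_copy_def split: if_splits)
    then show ?thesis using Copy.IH Copy.prems(1) by (simp add: elem_copy_def)
  qed
next
  case (Fact t)
  then have "eval (hyper_alg H) v t = Zero_el \<or> eval (hyper_alg H) v t = One_el"
    by (auto simp: elem_exp_def split: if_splits)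
  then show ?case using Fact.IH Fact.prems(1) by (auto simp: elem_exp_def)
next
  case (Exp2 t)
  then have "eval (hyper_alg H) v t = Zero_el \<or> eval (hyper_alg H) v t = One_el"
    by (auto simp: elem_exp_def split: if_splits)
  then show ?case using Exp2.IH Exp2.prems(1) by (auto simp: elem_exp_def)
qed simp_all

text \<open>
  Conversely to \<open>eval_transl\<close>, the value \<open>Top\<close> is witnessed by some colouring. Either it
  comes from a subterm with value \<open>Top\<close>, and the other arguments cannot remove it as they are
  nonzero, or it arises at this operation: then a sum has two distinct nonzero summands, a
  product is treated by \<open>transl_detects_Top\<close>, and the remaining operations have an argument that
  some colouring tells apart from 1.
\<close>

lemma eval_Top:
  assumes "\<forall>n\<in>vars t. visible U (v n)" "eval (hyper_alg H) v t = Top"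
  shows "\<exists>f. exactly_one (near H U) f \<and> eval S70 (\<lambda>n. transl f (v n)) t = Einf"
  using assms
proof (induction t)
  case (Var n)
  then show ?case using colouring by auto
next
  case (Plus s t)
  let ?x = "eval (hyper_alg H) v s" and ?y = "eval (hyper_alg H) v t"
  show ?case
  proof (cases "?x = Top \<or> ?y = Top")
    case True
    then consider "?x = Top" | "?y = Top" by blast
    then show ?thesis
    proof cases
      case 1
      obtain f where "exactly_one (near H U) f" "eval S70 (\<lambda>n. transl f (v n)) s = Einf"
        using Plus.IH(1) Plus.prems(1) 1 by auto
      then show ?thesis by (intro exI[of _ f]) simp
    next
      case 2
      obtain f where "exactly_one (near H U) f" "eval S70 (\<lambda>n. transl f (v n)) t = Einf"
        using Plus.IH(2) Plus.prems(1) 2 by auto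
      then show ?thesis by (intro exI[of _ f]) simp
    qed
  next
    case False
    then have neq: "?x \<noteq> ?y" "?x \<noteq> Zero_el" "?y \<noteq> Zero_el" using Plus.prems(2)
      by (auto simp: elem_plus_def split: if_splits)
    obtain f where f: "exactly_one (near H U) f" "transl f ?x \<noteq> transl f ?y"
      using transl_separates[OF neq(1)] by blast
    have "s7_plus (transl f ?x) (transl f ?y) = Einf"
      using f(2) neq(2,3) transl_eq_E0[of f ?x] transl_eq_E0[of f ?y]
      by (cases "transl f ?x"; cases "transl f ?y"; simp)
    then show ?thesis using f(1) eval_transl[OF f(1)] Plus.prems(1) False by auto
  qed
next
  case (Times s t)
  let ?x = "eval (hyper_alg H) v s" and ?y = "eval (hyper_alg H) v t"
  have "elem_times H ?x ?y \<noteq> Zero_el" using Times.prems(2) by simp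
  then have nz: "?x \<noteq> Zero_el" "?y \<noteq> Zero_el" by simp_all
  have nz7: "eval S70 (\<lambda>n. transl f (v n)) s \<noteq> E0" "eval S70 (\<lambda>n. transl f (v n)) t \<noteq> E0" for f
    using nz eval_eq_Zero_iff by blast+
  show ?case
  proof (cases "?x = Top \<or> ?y = Top")
    case True
    then consider "?x = Top" | "?y = Top" by blast
    then show ?thesis
    proof cases
      case 1
      obtain f where "exactly_one (near H U) f" "eval S70 (\<lambda>n. transl f (v n)) s = Einf"
        using Times.IH(1) Times.prems(1) 1 by auto
      then show ?thesis using nz7 by (intro exI[of _ f]) simp
    next
      case 2
      obtain f where "exactly_one (near H U) f" "eval S70 (\<lambda>n. transl f (v n)) t = Einf"
        using Times.IH(2) Times.prems(1) 2 by auto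
      then show ?thesis using nz7 by (intro exI[of _ f]) simp
    qed
  next
    case False
    obtain f where f: "exactly_one (near H U) f" "s7_times (transl f ?x) (transl f ?y) = Einf"
      using transl_detects_Top[of ?x ?y] Times.prems(2) by auto
    then show ?thesis using f(1) eval_transl[OF f(1)] Times.prems(1) False by auto
  qed
next
  case (Copy s t)
  let ?x = "eval (hyper_alg H) v s" and ?y = "eval (hyper_alg H) v t"
  have nz: "?x \<noteq> Zero_el" "?y \<noteq> Zero_el" and not1: "?x \<noteq> One_el \<or> ?y \<noteq> One_el"
    using Copy.prems(2) by (auto simp: elem_copy_def split: if_splits)
  have nz7: "eval S70 (\<lambda>n. transl f (v n)) s \<noteq> E0" "eval S70 (\<lambda>n. transl f (v n)) t \<noteq> E0" for f
    using nz eval_eq_Zero_iff by blast+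
  show ?case
  proof (cases "?x = Top \<or> ?y = Top")
    case True
    then consider "?x = Top" | "?y = Top" by blast
    then show ?thesis
    proof cases
      case 1
      obtain f where "exactly_one (near H U) f" "eval S70 (\<lambda>n. transl f (v n)) s = Einf"
        using Copy.IH(1) Copy.prems(1) 1 by auto
      then show ?thesis using nz7 by (intro exI[of _ f]) simp
    next
      case 2
      obtain f where "exactly_one (near H U) f" "eval S70 (\<lambda>n. transl f (v n)) t = Einf"
        using Copy.IH(2) Copy.prems(1) 2 by auto
      then show ?thesis using nz7 by (intro exI[of _ f]) simp
    qed
  next
    case False
    obtain f where f: "exactly_one (near H U) f" "transl f ?x \<noteq> E1 \<or> transl f ?y \<noteq> E1"
      using not1 transl_separates[of ?x One_el] transl_separates[of ?y One_el] by auto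
    then have "s7_copy (transl f ?x) (transl f ?y) = Einf"
      using nz transl_eq_E0[of f ?x] transl_eq_E0[of f ?y]
      by (cases "transl f ?x"; cases "transl f ?y"; simp)
    then show ?thesis using f(1) eval_transl[OF f(1)] Copy.prems(1) False by auto
  qed
next
  case (Fact t)
  let ?x = "eval (hyper_alg H) v t"
  have x: "?x \<noteq> Zero_el" "?x \<noteq> One_el" using Fact.prems(2) by (auto simp: elem_exp_def)
  show ?case
  proof (cases "?x = Top")
    case True
    then obtain f where "exactly_one (near H U) f" "eval S70 (\<lambda>n. transl f (v n)) t = Einf"
      using Fact.IH Fact.prems(1) by auto
    then show ?thesis by (intro exI[of _ f]) simp
  next
    case False
    obtain f where f: "exactly_one (near H U) f" "transl f ?x \<noteq> E1"
      using transl_separates[OF x(2)] by auto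
    then have "s7_fact (transl f ?x) = Einf"
      using x(1) transl_eq_E0[of f ?x] by (cases "transl f ?x"; simp)
    then show ?thesis using f(1) eval_transl[OF f(1)] Fact.prems(1) False by auto
  qed
next
  case (Exp2 t)
  let ?x = "eval (hyper_alg H) v t"
  have x: "?x \<noteq> Zero_el" "?x \<noteq> One_el" using Exp2.prems(2) by (auto simp: elem_exp_def)
  show ?case
  proof (cases "?x = Top")
    case True
    then obtain f where "exactly_one (near H U) f" "eval S70 (\<lambda>n. transl f (v n)) t = Einf"
      using Exp2.IH Exp2.prems(1) by auto
    then show ?thesis by (intro exI[of _ f]) simp
  next
    case False
    obtain f where f: "exactly_one (near H U) f" "transl f ?x \<noteq> E1"
      using transl_separates[OF x(2)] by auto
    then have "s7_exp2 (transl f ?x) = Einf"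
      using x(1) transl_eq_E0[of f ?x] by (cases "transl f ?x"; simp)
    then show ?thesis using f(1) eval_transl[OF f(1)] Exp2.prems(1) False by auto
  qed
qed simp_all

lemma local_identity:
  assumes "satisfies S70 (s, t)" "\<forall>n\<in>vars s \<union> vars t. visible U (v n)"
  shows "eval (hyper_alg H) v s = eval (hyper_alg H) v t"
proof -
  have eq: "eval S70 (\<lambda>n. transl f (v n)) s = eval S70 (\<lambda>n. transl f (v n)) t" for f
    using assms(1) by (simp add: satisfies_def)
  have not_Top: "eval (hyper_alg H) v t \<noteq> Top"
    if s: "eval (hyper_alg H) v s \<noteq> Top"
      and eq: "\<And>f. eval S70 (\<lambda>n. transl f (v n)) s = eval S70 (\<lambda>n. transl f (v n)) t"
      and vis: "\<forall>n\<in>vars s \<union> vars t. visible U (v n)" for s t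
  proof
    assume "eval (hyper_alg H) v t = Top"
    then obtain f where f: "exactly_one (near H U) f" "eval S70 (\<lambda>n. transl f (v n)) t = Einf"
      using eval_Top[of t v] vis by auto
    have "transl f (eval (hyper_alg H) v s) = Einf"
      using eval_transl[OF f(1) _ s] vis eq[of f] f(2) by simp
    then show False using s by (cases "eval (hyper_alg H) v s") (auto split: if_splits)
  qed
  show ?thesis
  proof (cases "eval (hyper_alg H) v s = Top \<or> eval (hyper_alg H) v t = Top")
    case True
    then show ?thesis using not_Top[of s t] not_Top[of t s] eq assms(2) by (metis Un_commute)
  next
    case False
    have "transl f (eval (hyper_alg H) v s) = transl f (eval (hyper_alg H) v t)"
      if f: "exactly_one (near H U) f" for f
      using eval_transl[OF f, of s v] eval_transl[OF f, of t v] eq[of f] assms(2) False by simp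
    then show ?thesis using transl_separates by blast
  qed
qed

end

text \<open>
  The variables in \<open>W\<close> take at most \<open>card W\<close> vertices as values, so at most the square of that many
  edges matter, and these form an acyclic family.
\<close>

lemma hyper_alg_satisfies:
  assumes H: "\<forall>e\<in>H. card e = 3" "locally_leafy K H"
    and W: "finite W" "card W * card W \<le> K"
    and st: "satisfies S70 (s, t)" "vars s \<union> vars t \<subseteq> W"
  shows "satisfies (hyper_alg H) (s, t)"
  unfolding satisfies_def
proof (intro allI impI)
  fix v :: "nat \<Rightarrow> elem"
  define U where "U = {u. \<exists>n\<in>W. v n = Vert u}"
  have sub: "Vert ` U \<subseteq> v ` W" unfolding U_def by (force simp: image_iff)
  have finU: "finite U"
    using finite_imageD[of Vert U] finite_subset[OF sub] W(1) by (simp add: inj_on_def)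
  have "card U = card (Vert ` U)" by (simp add: card_image inj_on_def)
  also have "\<dots> \<le> card W" by (rule surj_card_le[OF W(1) sub])
  finally have "card U * card U \<le> K" using W(2) mult_le_mono le_trans by blast
  then have "card (near H U) \<le> K" using near_small(2)[OF finU, of H] by linarith
  moreover have "near H U \<subseteq> H" by (auto simp: near_def)
  ultimately have "leafy (near H U)"
    using H(2) near_small(1)[OF finU, of H] unfolding locally_leafy_def by blast
  then interpret local_view H U
    using H(1) near_small(1)[OF finU] by unfold_locales auto
  have "\<forall>n\<in>vars s \<union> vars t. visible U (v n)"
    using st(2) by (auto simp: visible_def U_def)
  then show "eval (hyper_alg H) v (fst (s, t)) = eval (hyper_alg H) v (snd (s, t))"
    using local_identity[OF st(1)] by simp
qed

section \<open>An identity that is not locally derivable\<close>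

text \<open>
  Products and sums of nonempty lists; the value at the empty list is a dummy, as the signature
  need not contain the constants.
\<close>

fun prod_of :: "nat list \<Rightarrow> trm" where
  "prod_of [] = Var 0"
| "prod_of [x] = Var x"
| "prod_of (x # y # zs) = Times (Var x) (prod_of (y # zs))"

fun sum_of :: "trm list \<Rightarrow> trm" where
  "sum_of [] = Var 0"
| "sum_of [t] = t"
| "sum_of (t # t' # ts) = Plus t (sum_of (t' # ts))"

lemma symbs_prod_of: "symbs (prod_of xs) \<subseteq> {TimesS}"
  by (induction xs rule: prod_of.induct) auto

lemma symbs_sum_of: "(\<Union>t\<in>set ts. symbs t) \<subseteq> T \<Longrightarrow> symbs (sum_of ts) \<subseteq> insert PlusS T"
  by (induction ts rule: sum_of.induct) auto

lemma s7_times_eq_E1: "s7_times x y = E1 \<longleftrightarrow> x = E1 \<and> y = E1"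
  by (cases x; cases y; simp)

lemma s7_times_eq_Ea: "s7_times x y = Ea \<longleftrightarrow> x = Ea \<and> y = E1 \<or> x = E1 \<and> y = Ea"
  by (cases x; cases y; simp)

text \<open>
  Flatness: nonzero summands of a sum other than \<open>\<infinity>\<close> coincide with the sum.
\<close>

lemma s7_plus_eqD: "s7_plus x y = c \<Longrightarrow> c \<noteq> Einf \<Longrightarrow> x \<noteq> E0 \<Longrightarrow> y \<noteq> E0 \<Longrightarrow> x = c \<and> y = c"
  by (cases x; cases y; simp)

lemma eval_prod_of_E0: "xs \<noteq> [] \<Longrightarrow> eval S70 v (prod_of xs) = E0 \<longleftrightarrow> (\<exists>x\<in>set xs. v x = E0)"
  by (induction xs rule: prod_of.induct) auto

lemma eval_prod_of_E1: "xs \<noteq> [] \<Longrightarrow> eval S70 v (prod_of xs) = E1 \<longleftrightarrow> (\<forall>x\<in>set xs. v x = E1)"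
  by (induction xs rule: prod_of.induct) (auto simp: s7_times_eq_E1)

lemma eval_prod_of_Ea:
  "xs \<noteq> [] \<Longrightarrow> distinct xs \<Longrightarrow> eval S70 v (prod_of xs) = Ea \<Longrightarrow> \<exists>!x. x \<in> set xs \<and> v x = Ea"
proof (induction xs rule: prod_of.induct)
  case (3 x y zs)
  then consider "v x = Ea" "\<forall>z\<in>set (y # zs). v z = E1"
    | "v x = E1" "eval S70 v (prod_of (y # zs)) = Ea"
    using eval_prod_of_E1[of "y # zs" v] by (auto simp: s7_times_eq_Ea)
  then show ?case
  proof cases
    case 1
    then show ?thesis by (intro ex1I[of _ x]) auto
  next
    case 2
    then obtain z where z: "z \<in> set (y # zs) \<and> v z = Ea" "\<And>w. w \<in> set (y # zs) \<and> v w = Ea \<Longrightarrow> w = z"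
      using 3 by (metis distinct.simps(2) list.discI)
    have "w = z" if "w \<in> set (x # y # zs) \<and> v w = Ea" for w
      using that z(2)[of w] 2(1) by auto
    then show ?thesis using z(1) by (intro ex1I[of _ z]) auto
  qed
qed auto

lemma eval_sum_of_nonzero:
  "ts \<noteq> [] \<Longrightarrow> \<forall>t\<in>set ts. eval S70 v t \<noteq> E0 \<Longrightarrow> eval S70 v (sum_of ts) \<noteq> E0"
  by (induction ts rule: sum_of.induct) auto

lemma eval_sum_of_summand:
  "\<forall>t\<in>set ts. eval S70 v t \<noteq> E0 \<Longrightarrow> eval S70 v (sum_of ts) = c \<Longrightarrow> c \<noteq> Einf
    \<Longrightarrow> t \<in> set ts \<Longrightarrow> eval S70 v t = c"
proof (induction ts arbitrary: t rule: sum_of.induct)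
  case (3 t1 t2 ts)
  have "eval S70 v t1 \<noteq> E0" "eval S70 v (sum_of (t2 # ts)) \<noteq> E0"
    using 3(2) eval_sum_of_nonzero[of "t2 # ts" v] by auto
  then have "eval S70 v t1 = c \<and> eval S70 v (sum_of (t2 # ts)) = c"
    using 3(3,4) by (intro s7_plus_eqD) auto
  then show ?case using 3(1)[of t] 3(2,4,5) by (cases "t = t1") simp_all
qed auto

lemma hyper_alg_sum_of:
  "ts \<noteq> [] \<Longrightarrow> \<forall>t\<in>set ts. eval (hyper_alg H) v t = c \<Longrightarrow> eval (hyper_alg H) v (sum_of ts) = c"
  by (induction ts rule: sum_of.induct) (auto simp: elem_plus_def)

lemma hyper_alg_prod_of:
  "eval (hyper_alg H) Vert (prod_of xs) \<notin> {Zero_el, One_el}"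
proof (induction xs rule: prod_of.induct)
  case (3 x y zs)
  then show ?case by (cases "eval (hyper_alg H) Vert (prod_of (y # zs))") auto
qed auto

definition edge_sum :: "nat set set \<Rightarrow> trm" where
  "edge_sum H = sum_of (map (\<lambda>e. prod_of (sorted_list_of_set e)) (SOME es. set es = H))"

definition vertex_square :: "nat set set \<Rightarrow> trm" where
  "vertex_square H = (let q = prod_of (sorted_list_of_set (\<Union>H)) in Times q q)"

context
  fixes H :: "nat set set"
  assumes finH: "finite H" and H0: "H \<noteq> {}" and card3: "\<And>e. e \<in> H \<Longrightarrow> card e = 3"
begin

lemma edges_list: obtains es where "set es = H" "es \<noteq> []"
  "edge_sum H = sum_of (map (\<lambda>e. prod_of (sorted_list_of_set e)) es)"
proof -
  have "set (SOME es. set es = H) = H" using finite_list[OF finH] by (rule someI_ex)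
  then show thesis using that H0 unfolding edge_sum_def by fastforce
qed

lemma edge_list: "e \<in> H \<Longrightarrow> finite e \<and> sorted_list_of_set e \<noteq> []"
  using card3[of e] by (metis card.infinite card.empty sorted_list_of_set_eq_Nil_iff zero_neq_numeral)

lemma vertices_list: "finite (\<Union>H)" "sorted_list_of_set (\<Union>H) \<noteq> []"
proof -
  show *: "finite (\<Union>H)" using finH edge_list by blast
  obtain e where "e \<in> H" using H0 by blast
  then have "e \<noteq> {}" "e \<subseteq> \<Union>H" using card3 by force+
  then show "sorted_list_of_set (\<Union>H) \<noteq> []" using * by (auto simp: sorted_list_of_set_eq_Nil_iff)
qed

lemma critical_equation_terms:
  "{PlusS, TimesS} \<subseteq> \<tau> \<Longrightarrow> (edge_sum H, Plus (edge_sum H) (vertex_square H)) \<in> terms \<tau> \<times> terms \<tau>"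
proof -
  assume \<tau>: "{PlusS, TimesS} \<subseteq> \<tau>"
  obtain es where es: "edge_sum H = sum_of (map (\<lambda>e. prod_of (sorted_list_of_set e)) es)"
    using edges_list by blast
  have "symbs (edge_sum H) \<subseteq> insert PlusS {TimesS}"
    unfolding es using symbs_prod_of by (intro symbs_sum_of) fastforce
  moreover have "symbs (vertex_square H) \<subseteq> {TimesS}"
    using symbs_prod_of[of "sorted_list_of_set (\<Union>H)"] by (auto simp: vertex_square_def Let_def)
  ultimately show ?thesis using \<tau> by (auto simp: terms_def)
qed

text \<open>
  Let \<open>q\<close> be the product of all vertices, so that the square of \<open>q\<close> is added on the right. If some
  vertex is 0, then \<open>q\<close> is 0. Otherwise the sum over the edges is nonzero. If it is 1 then all
  vertices are 1, and so is \<open>q\<close>; if it is \<open>\<infinity>\<close>, it absorbs the square; and it cannot be \<open>a\<close>, since then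
  the vertices with value \<open>a\<close> would give an exactly-one colouring.
\<close>

lemma critical_equation_S70:
  assumes "\<nexists>f. exactly_one H f"
  shows "satisfies S70 (edge_sum H, Plus (edge_sum H) (vertex_square H))"
  unfolding satisfies_def
proof (intro allI impI)
  fix v :: "nat \<Rightarrow> s7"
  obtain es where es: "set es = H" "es \<noteq> []"
    "edge_sum H = sum_of (map (\<lambda>e. prod_of (sorted_list_of_set e)) es)"
    using edges_list by blast
  let ?\<sigma> = "eval S70 v (edge_sum H)" and ?q = "eval S70 v (prod_of (sorted_list_of_set (\<Union>H)))"
  have "?\<sigma> = s7_plus ?\<sigma> (s7_times ?q ?q)"
  proof (cases "?q = E0")
    case True
    then show ?thesis by simp
  next
    case False
    then have nz: "\<forall>e\<in>H. \<forall>x\<in>e. v x \<noteq> E0"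
      using eval_prod_of_E0[OF vertices_list(2)] vertices_list(1) by auto
    then have nzt: "\<forall>t\<in>set (map (\<lambda>e. prod_of (sorted_list_of_set e)) es). eval S70 v t \<noteq> E0"
    proof -
      have "eval S70 v (prod_of (sorted_list_of_set e)) \<noteq> E0" if "e \<in> H" for e
        using eval_prod_of_E0[of "sorted_list_of_set e" v] edge_list[OF that] nz that by auto
      then show ?thesis using es(1) by auto
    qed
    have \<sigma>0: "?\<sigma> \<noteq> E0" using eval_sum_of_nonzero[OF _ nzt] es by simp
    have edge: "eval S70 v (prod_of (sorted_list_of_set e)) = ?\<sigma>" if "?\<sigma> \<noteq> Einf" "e \<in> H" for e
    proof (rule eval_sum_of_summand[OF nzt _ that(1)])
      show "eval S70 v (sum_of (map (\<lambda>e. prod_of (sorted_list_of_set e)) es)) = ?\<sigma>"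
        by (simp only: es(3))
      show "prod_of (sorted_list_of_set e) \<in> set (map (\<lambda>e. prod_of (sorted_list_of_set e)) es)"
        using that(2) es(1) by auto
    qed
    show ?thesis
    proof (cases ?\<sigma>)
      case E0
      then show ?thesis using \<sigma>0 by simp
    next
      case E1
      have "v x = E1" if "e \<in> H" "x \<in> e" for e x
        using edge[OF _ that(1)] E1 eval_prod_of_E1[of "sorted_list_of_set e" v] edge_list[OF that(1)]
          that(2) by simp
      then have "?q = E1"
        using eval_prod_of_E1[OF vertices_list(2)] vertices_list(1) by auto
      then show ?thesis using E1 by simp
    next
      case Ea
      have "\<exists>!x. x \<in> e \<and> v x = Ea" if "e \<in> H" for e
        using eval_prod_of_Ea[of "sorted_list_of_set e" v] edge[OF _ that] edge_list[OF that] Ea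
        by simp
      then have "exactly_one H (\<lambda>x. v x = Ea)" by (simp add: exactly_one_def)
      then show ?thesis using assms by blast
    next
      case Einf
      then show ?thesis by simp
    qed
  qed
  then show "eval S70 v (fst (edge_sum H, Plus (edge_sum H) (vertex_square H)))
      = eval S70 v (snd (edge_sum H, Plus (edge_sum H) (vertex_square H)))"
    by (simp add: vertex_square_def Let_def)
qed

text \<open>
  Assign each vertex to itself. All edges have the product \<open>Atom\<close>, by linearity of the
  hypergraph, and so has their sum. But \<open>q\<close> is neither 0 nor 1, and the square of such an element is
  \<open>Top\<close>, so the right side is \<open>Top\<close>.
\<close>

lemma critical_equation_hyper_alg:
  assumes "locally_leafy K H" "2 \<le> K"
  shows "\<not> satisfies (hyper_alg H) (edge_sum H, Plus (edge_sum H) (vertex_square H))"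
proof -
  have edge: "eval (hyper_alg H) Vert (prod_of (sorted_list_of_set e)) = Atom" if "e \<in> H" for e
  proof -
    have fin: "finite e" using edge_list[OF that] by blast
    have "length (sorted_list_of_set e) = Suc (Suc (Suc 0))" using card3[OF that] by simp
    then obtain u v w where l: "sorted_list_of_set e = [u, v, w]"
      unfolding length_Suc_conv length_0_conv by blast
    have e: "e = {u, v, w}" using set_sorted_list_of_set[OF fin] l by auto
    have d: "u \<noteq> v" "u \<noteq> w" "v \<noteq> w" using distinct_sorted_list_of_set[of e] l by auto
    have "{v, w, u} \<in> H" using e that by (simp add: insert_commute)
    then have "{v, w, third H v w} \<in> H" by (rule third_edge)
    moreover from this have "{v, w, third H v w} = e"
      using locally_leafy_linear[OF assms _ that, of "{v, w, third H v w}" v w] e d by auto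
    ultimately have "third H v w = u" using card3[of "{v, w, third H v w}"] e d
      by (auto simp: card_insert_if split: if_splits)
    then show ?thesis using l \<open>{v, w, third H v w} \<in> H\<close> by (simp add: vert_times_def)
  qed
  obtain es where es: "set es = H" "es \<noteq> []"
    "edge_sum H = sum_of (map (\<lambda>e. prod_of (sorted_list_of_set e)) es)"
    using edges_list by blast
  have "eval (hyper_alg H) Vert (edge_sum H) = Atom"
    unfolding es(3) using es(1,2) edge by (intro hyper_alg_sum_of) auto
  moreover have "eval (hyper_alg H) Vert (vertex_square H) \<noteq> Zero_el"
    using hyper_alg_prod_of[of H "sorted_list_of_set (\<Union>H)"] by (simp add: vertex_square_def Let_def)
  \<comment> \<open>Being neither zero nor \<open>Atom\<close> already suffices to push the sum up to \<open>Top\<close>.\<close>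
  moreover have "elem_times H x x \<noteq> Atom" for x
    by (cases x) (auto simp: vert_times_def)
  then have "eval (hyper_alg H) Vert (vertex_square H) \<noteq> Atom"
    by (simp add: vertex_square_def Let_def)
  ultimately have "eval (hyper_alg H) Vert (edge_sum H)
      \<noteq> eval (hyper_alg H) Vert (Plus (edge_sum H) (vertex_square H))"
    by (simp add: elem_plus_def)
  then show ?thesis by (auto simp: satisfies_def)
qed

end

theorem corollary3p8:
  fixes \<tau> :: "symb set"
  assumes "{PlusS, TimesS} \<subseteq> \<tau>"
    and "\<tau> \<subseteq> {PlusS, TimesS, CopyS, FactS, Exp2S, ZeroS, OneS}"
  shows "\<not> finitely_based \<tau> S70"
proof
  assume "finitely_based \<tau> S70"
  then obtain E where E: "finite E" "E \<subseteq> identities \<tau> S70"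
    "\<And>e. e \<in> identities \<tau> S70 \<Longrightarrow> entails \<tau> E e"
    unfolding finitely_based_def by blast
  define W where "W = (\<Union>(s, t)\<in>E. vars s \<union> vars t)"
  have finW: "finite W" using E(1) finite_vars by (auto simp: W_def)
  \<comment> \<open>The square bounds the number of edges that matter for a valuation, and 2 ensures linearity.\<close>
  define K where "K = card W * card W + 2"
  obtain H :: "nat set set" where H: "finite H" "H \<noteq> {}" "\<forall>e\<in>H. card e = 3" "locally_leafy K H"
    "\<nexists>f. exactly_one H f"
    using leafy_hypergraph_exists by blast
  have c3: "\<And>e. e \<in> H \<Longrightarrow> card e = 3" using H(3) by blast
  let ?e = "(edge_sum H, Plus (edge_sum H) (vertex_square H))"
  have e: "?e \<in> terms \<tau> \<times> terms \<tau>" by (rule critical_equation_terms[OF H(1,2) c3 assms(1)])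
  moreover have "satisfies S70 ?e" by (rule critical_equation_S70[OF H(1,2) c3 H(5)])
  ultimately have "entails \<tau> E ?e" using E(3) by (simp add: identities_def)
  moreover have "satisfies (hyper_alg H) (s, t)" if "(s, t) \<in> E" for s t
    using that E(2) finW
    by (intro hyper_alg_satisfies[OF H(3,4), of W]) (auto simp: K_def W_def identities_def)
  then have "\<forall>d\<in>E. satisfies (hyper_alg H) d" by auto
  moreover have "E \<subseteq> terms \<tau> \<times> terms \<tau>" using E(2) by (auto simp: identities_def)
  ultimately have "satisfies (hyper_alg H) ?e"
    using entails_all_algebras[OF _ _ e algebra_of_hyper_alg] by blast
  moreover have "\<not> satisfies (hyper_alg H) ?e"
    by (rule critical_equation_hyper_alg[OF H(1,2) c3 H(4)]) (simp_all add: K_def)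
  ultimately show False by blast
qed

end
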